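(* The cardinal $\mathfrak q_0$ is equal to each of the following cardinals: \begin{itemize} \item the smallest cardinality of a submetrizable space which is not a $Q$-space; \item the smallest cardinality of a non-perfect submetrizable space; \item the smallest cardinality of an $\mathsf{nw}$-countable functionally Hausdorff space which is not a $Q$-space; \item the smallest cardinality of a non-perfect $\mathsf{nw}$-countable functionally Hausdorff space; \item the smallest cardinality of a second-countable functionally Hausdorff space which is not a $Q$-space; \item the smallest cardinality of a non-perfect second-countable functionally Hausdorff space. \end{itemize}
   Context: A subset of a topological space is of type $F_\sigma$ if it can be written as the union of countably many closed sets. A topological space $X$ is perfect if every open subset of $X$ is of type $F_\sigma$ in $X$; it is non-perfect if it is not perfect. A topological space $X$ is a $Q$-space if every subset of $X$ is of type $F_\sigma$ in $X$. The cardinal $\mathfrak q_0$ is the smallest cardinality of a subset of $\mathbb R$ (with the subspace topology) which is not a $Q$-space. A topological space $X$ is submetrizable if there exists a continuous bijective map $f:X\to Y$ onto a metric space $Y$. $X$ is functionally Hausdorff if for any distinct points $x,y\in X$ there exists a continuous function $f:X\to\mathbb R$ such that $f(x)\ne f(y)$. A family $\mathcal F$ of subsets of $X$ is a network if for every open set $U\subseteq X$ and point $x\in U$ there exists $F\in\mathcal F$ such that $x\in F\subseteq U$. $X$ is $\mathsf{nw}$-countable if it has a countable network. $X$ is second-countable if it has a countable base of the topology. *)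

theory Defs
  imports "HOL-Analysis.Analysis"
begin

unbundle cardinal_syntax

definition Q_space :: "'a topology \<Rightarrow> bool"
  where "Q_space X \<longleftrightarrow> (\<forall>S. S \<subseteq> topspace X \<longrightarrow> fsigma_in X S)"

text \<open>Unrelated to the type class \<open>perfect_space\<close> (spaces without isolated points).\<close>
definition perfect_fsigma_space :: "'a topology \<Rightarrow> bool"
  where "perfect_fsigma_space X \<longleftrightarrow> (\<forall>U. openin X U \<longrightarrow> fsigma_in X U)"

text \<open>Since \<open>f\<close> is a bijection, the metric can be carried by a subset of the type of the points
  of \<open>X\<close> without loss of generality.\<close>
definition submetrizable_space :: "'a topology \<Rightarrow> bool"
  where "submetrizable_space X \<longleftrightarrow>
    (\<exists>(M :: 'a set) d f. Metric_space M d \<and>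
        continuous_map X (Metric_space.mtopology M d) f \<and> bij_betw f (topspace X) M)"

definition functionally_Hausdorff_space :: "'a topology \<Rightarrow> bool"
  where "functionally_Hausdorff_space X \<longleftrightarrow>
    (\<forall>x \<in> topspace X. \<forall>y \<in> topspace X. x \<noteq> y \<longrightarrow>
        (\<exists>f. continuous_map X euclideanreal f \<and> f x \<noteq> f y))"

definition network_of :: "'a topology \<Rightarrow> 'a set set \<Rightarrow> bool"
  where "network_of X \<F> \<longleftrightarrow> (\<forall>F \<in> \<F>. F \<subseteq> topspace X) \<and>
    (\<forall>U x. openin X U \<and> x \<in> U \<longrightarrow> (\<exists>F \<in> \<F>. x \<in> F \<and> F \<subseteq> U))"

definition nw_countable :: "'a topology \<Rightarrow> bool"
  where "nw_countable X \<longleftrightarrow> (\<exists>\<F>. countable \<F> \<and> network_of X \<F>)"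

text \<open>A cardinal is represented by the well-order \<open>|A|\<close> of some set \<open>A\<close>, hence is only determined
  up to \<open>=o\<close>. The two lemmas \<open>q0_attained\<close> and \<open>q0_least\<close> below show that the choice is always
  possible.\<close>
definition q0 :: "real rel"
  where "q0 = (SOME r. (\<exists>A :: real set. \<not> Q_space (top_of_set A) \<and> r = |A| ) \<and>
                       (\<forall>B :: real set. \<not> Q_space (top_of_set B) \<longrightarrow> r \<le>o |B| ))"

lemma not_Q_space_real: "\<not> Q_space euclideanreal"
proof
  assume "Q_space euclideanreal"
  then have "fsigma_in euclideanreal (- \<rat>)"
    by (simp add: Q_space_def)
  then obtain \<T> :: "real set set"
    where "countable \<T>" and "\<T> \<subseteq> Collect (closedin euclideanreal)" and "\<Union>\<T> = - \<rat>"
    unfolding fsigma_in_def union_of_def by blast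
  then have \<T>: "countable \<T>" "\<And>T. T \<in> \<T> \<Longrightarrow> closed T" "\<Union>\<T> = - \<rat>"
    by auto
  define \<G> where "\<G> = \<T> \<union> (\<lambda>q::real. {q}) ` \<rat>"
  have "euclideanreal interior_of \<Union>\<G> = {}"
  proof (rule Baire_category_alt)
    show "completely_metrizable_space euclideanreal \<or>
          locally_compact_space euclideanreal \<and> regular_space euclideanreal"
      by (simp add: completely_metrizable_space_euclidean)
    show "countable \<G>"
      by (simp add: \<G>_def \<T> countable_rat)
  next
    fix T assume "T \<in> \<G>"
    then consider "T \<in> \<T>" | q where "T = {q}"
      by (auto simp: \<G>_def)
    then show "closedin euclideanreal T \<and> euclideanreal interior_of T = {}"
    proof cases
      case 1
      then have "T \<subseteq> - \<rat>"
        using \<T> by blast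
      then have "interior T \<subseteq> interior (- \<rat>)"
        by (rule interior_mono)
      also have "\<dots> = {}"
        by (simp add: interior_complement Rats_closure_real)
      finally show ?thesis
        using 1 \<T> by simp
    next
      case 2
      then show ?thesis
        by simp
    qed
  qed
  moreover have "\<Union>\<G> = UNIV"
    using \<T> by (auto simp: \<G>_def)
  ultimately show False
    by simp
qed

lemma q0_exists:
  "\<exists>r. (\<exists>A :: real set. \<not> Q_space (top_of_set A) \<and> r = |A| ) \<and>
       (\<forall>B :: real set. \<not> Q_space (top_of_set B) \<longrightarrow> r \<le>o |B| )"
proof -
  let ?R = "card_of ` {A :: real set. \<not> Q_space (top_of_set A)}"
  have "?R \<noteq> {}"
  proof -
    have "\<not> Q_space (top_of_set (UNIV :: real set))"
      using not_Q_space_real by simp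
    then have "UNIV \<in> {A :: real set. \<not> Q_space (top_of_set A)}"
      by simp
    then show ?thesis
      by blast
  qed
  then have "\<exists>r \<in> ?R. \<forall>r' \<in> ?R. r \<le>o r'"
    by (rule exists_minim_Card_order) (simp add: card_of_Card_order)
  then obtain A :: "real set" where A: "\<not> Q_space (top_of_set A)"
    and le: "\<forall>r' \<in> ?R. |A| \<le>o r'"
    by (elim bexE imageE) simp
  show ?thesis
  proof (intro exI conjI allI impI)
    show "\<not> Q_space (top_of_set A)"
      by (rule A)
    fix B :: "real set"
    assume "\<not> Q_space (top_of_set B)"
    then have "|B| \<in> ?R"
      by (intro imageI) simp
    then show "|A| \<le>o |B|"
      using le by (rule bspec[rotated])
  qed (rule refl)
qed

lemma q0_attained: "\<exists>A :: real set. \<not> Q_space (top_of_set A) \<and> q0 = |A|"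
  unfolding q0_def using someI_ex[OF q0_exists] by (rule conjunct1)

lemma q0_least: "\<not> Q_space (top_of_set B) \<Longrightarrow> q0 \<le>o |B|" for B :: "real set"
  unfolding q0_def using someI_ex[OF q0_exists] by (elim conjE allE[of _ B] impE)

end

theory Submission
  imports Defs
begin

text \<open>All six cardinals are bounded below by \<open>q0\<close> for one reason: a space \<open>X\<close> with fewer than \<open>q0\<close> points
  that carries a countable family of clopen sets separating its points is a \<open>Q\<close>-space. Listing the
  family as \<open>C 0, C 1, \<dots>\<close> and reading membership in the \<open>C i\<close> as digits gives a continuous injection of
  \<open>X\<close> into a Cantor set in the real line. Its image is a set of fewer than \<open>q0\<close> reals, hence a
  \<open>Q\<close>-space, and preimages of \<open>F\<^sub>\<sigma>\<close> sets are \<open>F\<^sub>\<sigma>\<close>.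

  Since \<open>Q\<close>-spaces are perfect, this covers the bounds for non-perfect spaces as well. Such clopen
  families exist since \<open>q0\<close> is at most the continuum: a continuous real function on a
  space with fewer points than the continuum omits a value in every interval, and cutting at an
  omitted value turns a separation by real functions into one by clopen sets. What remains is to see
  that it suffices to separate countably many pairs of sets. For a space with a countable network
  one takes the pairs of network elements. For a metric space, which may be far from separable, one
  uses A. H. Stone's construction: it covers the space by sets of small diameter that fall into
  countably many families, in each of which different sets have distance bounded away from zero. The
  members of a family are indexed by points, hence by distinct reals, and uniting those with index in
  a basic open set of reals leaves only countably many sets to be separated from what lies at a
  positive distance from them. A submetrizable space inherits the clopen family of its metric image.

  Conversely, let \<open>A\<close> be a set of \<open>q0\<close> reals that is not a \<open>Q\<close>-space, and \<open>S \<subseteq> A\<close> not of type \<open>F\<^sub>\<sigma>\<close>.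
  Declaring \<open>S\<close> open refines the topology of \<open>A\<close> to a second-countable, submetrizable, functionally
  Hausdorff topology in which \<open>S\<close> is still not \<open>F\<^sub>\<sigma>\<close>. This single non-perfect space attains all six
  bounds.\<close>

section \<open>Injecting a space into the Cantor set\<close>

text \<open>The digits are 0 and 1 rather than 0 and 2, so the range is the Cantor ternary set stretched by the
  factor 3/2.\<close>
definition cantor_sum :: "(nat \<Rightarrow> bool) \<Rightarrow> real"
  where "cantor_sum s = (\<Sum>i. of_bool (s i) / 3 ^ i)"

text \<open>A digit of weight \<open>1 / 3 ^ n\<close> exceeds the sum \<open>1 / (2 * 3 ^ n)\<close> of all later weights. This one estimate
  yields injectivity, because the first differing digit cannot be compensated, and continuity, because
  agreement in the first digits forces the sums to be close.\<close>
lemma cantor_sum_estimate: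
  assumes agree: "\<And>i. i < n \<Longrightarrow> s i = t i"
  shows "\<bar>cantor_sum s - cantor_sum t - (of_bool (s n) - of_bool (t n)) / 3 ^ n\<bar> \<le> 1 / (2 * 3 ^ n)"
proof -
  define u :: "nat \<Rightarrow> real" where "u i = (of_bool (s i) - of_bool (t i)) / 3 ^ i" for i
  have geo: "summable (\<lambda>i. (1/3::real) ^ i)"
    by (rule summable_geometric) simp
  have summ: "summable (\<lambda>i. of_bool (s i) / 3 ^ i :: real)" for s
    by (rule summable_comparison_test'[OF geo, of 0]) (simp add: power_one_over)
  have u: "summable u" and u_eq: "suminf u = cantor_sum s - cantor_sum t"
    using summable_diff[OF summ[of s] summ[of t]] suminf_diff[OF summ[of s] summ[of t]]
    by (simp_all add: u_def[abs_def] cantor_sum_def diff_divide_distrib)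
  have "(\<lambda>i. (1/3) ^ Suc n * (1/3::real) ^ i) sums ((1/3) ^ Suc n * (1 / (1 - 1/3)))"
    by (intro sums_mult geometric_sums) simp
  then have tail: "(\<lambda>i. (1/3) ^ (i + Suc n)) sums (1 / (2 * 3 ^ n) :: real)"
    by (simp add: power_add field_simps)
  have "(\<Sum>i<n. u i) = 0"
    by (rule sum.neutral) (simp add: u_def agree)
  then have split: "suminf u - u n = (\<Sum>i. u (i + Suc n))"
    using suminf_split_initial_segment[OF u, of "Suc n"] by simp
  have "\<bar>\<Sum>i. u (i + Suc n)\<bar> \<le> (\<Sum>i. (1/3) ^ (i + Suc n))"
    unfolding real_norm_def[symmetric]
  proof (rule norm_suminf_le)
    show "summable (\<lambda>i. (1/3::real) ^ (i + Suc n))"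
      using tail by (rule sums_summable)
    show "norm (u (i + Suc n)) \<le> (1/3) ^ (i + Suc n)" for i
      by (simp add: u_def power_one_over divide_simps)
  qed
  also have "\<dots> = 1 / (2 * 3 ^ n)"
    using tail by (rule sums_unique[symmetric])
  finally show ?thesis
    unfolding split[symmetric] u_eq by (simp only: u_def)
qed

lemma inj_cantor_sum: "inj cantor_sum"
proof (rule injI, rule ccontr)
  fix s t
  assume eq: "cantor_sum s = cantor_sum t" and "s \<noteq> t"
  then have ex: "\<exists>n. s n \<noteq> t n"
    by auto
  define n where "n = (LEAST n. s n \<noteq> t n)"
  have n: "s n \<noteq> t n"
    unfolding n_def by (rule LeastI_ex[OF ex])
  have "s i = t i" if "i < n" for i
    using not_less_Least[of i "\<lambda>n. s n \<noteq> t n"] that by (auto simp: n_def)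
  then have "\<bar>(of_bool (s n) - of_bool (t n) :: real) / 3 ^ n\<bar> \<le> 1 / (2 * 3 ^ n)"
    using cantor_sum_estimate[of n s t] eq by simp
  with n show False
    by (cases "s n") (auto simp: field_simps)
qed

text \<open>The points agreeing with \<open>x\<close> in the first \<open>n\<close> digits form an open set, because every \<open>C i\<close> is clopen.\<close>
lemma continuous_map_cantor_sum:
  assumes C: "\<And>i. openin X (C i)" "\<And>i. closedin X (C i)"
  shows "continuous_map X euclideanreal (\<lambda>x. cantor_sum (\<lambda>i. x \<in> C i))"
proof -
  let ?g = "\<lambda>x. cantor_sum (\<lambda>i. x \<in> C i)"
  have "continuous_map X Met_TC.mtopology ?g"
    unfolding Met_TC.continuous_map_to_metric
  proof (intro ballI allI impI)
    fix x and e :: real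
    assume x: "x \<in> topspace X" and "0 < e"
    then obtain n where n: "(1/3) ^ n < e / 2"
      using real_arch_pow_inv[of "e/2" "1/3"] by auto
    define D where "D i = (if x \<in> C i then C i else topspace X - C i)" for i
    let ?U = "topspace X \<inter> (\<Inter>i\<in>{..<n}. D i)"
    have "openin X (D i)" for i
      using C by (auto simp: D_def)
    then have "openin X ?U"
      by (cases "n = 0") (auto intro!: openin_Int openin_INT)
    moreover have "x \<in> ?U"
      using x by (auto simp: D_def)
    moreover have "?g y \<in> Met_TC.mball (?g x) e" if "y \<in> ?U" for y
    proof -
      have "(x \<in> C i) = (y \<in> C i)" if "i < n" for i
        using that \<open>y \<in> ?U\<close> by (auto simp: D_def split: if_splits)
      then have est: "\<bar>?g x - ?g y - (of_bool (x \<in> C n) - of_bool (y \<in> C n)) / 3 ^ n\<bar> \<le> 1 / (2 * 3 ^ n)"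
        by (rule cantor_sum_estimate)
      have "\<bar>(of_bool (x \<in> C n) - of_bool (y \<in> C n)) / 3 ^ n :: real\<bar> \<le> 1 / 3 ^ n"
        by auto
      with est have "\<bar>?g x - ?g y\<bar> \<le> 1 / 3 ^ n + 1 / (2 * 3 ^ n)"
        by linarith
      also have "\<dots> \<le> 2 * (1/3) ^ n"
        by (simp add: power_one_over field_simps)
      also have "\<dots> < e"
        using n by simp
      finally show ?thesis
        by (simp add: dist_real_def)
    qed
    ultimately show "\<exists>U. openin X U \<and> x \<in> U \<and> (\<forall>y\<in>U. ?g y \<in> Met_TC.mball (?g x) e)"
      by blast
  qed
  then show ?thesis
    by simp
qed

section \<open>Clopen separation and the Q-space property\<close>

lemma fsigma_in_continuous_map_preimage:
  assumes f: "continuous_map X Y f" and S: "fsigma_in Y S"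
  shows "fsigma_in X {x \<in> topspace X. f x \<in> S}"
proof -
  from S obtain C :: "nat \<Rightarrow> _" where C: "\<And>n. closedin Y (C n)" and S_eq: "\<Union>(range C) = S"
    unfolding fsigma_in_ascending by blast
  have "fsigma_in X (\<Union>n. {x \<in> topspace X. f x \<in> C n})"
    by (rule fsigma_in_Union)
      (auto intro: closed_imp_fsigma_in closedin_continuous_map_preimage[OF f C])
  also have "(\<Union>n. {x \<in> topspace X. f x \<in> C n}) = {x \<in> topspace X. f x \<in> S}"
    using S_eq by blast
  finally show ?thesis .
qed

lemma Q_space_continuous_inj_preimage:
  assumes f: "continuous_map X Y f" and inj: "inj_on f (topspace X)" and Y: "Q_space Y"
  shows "Q_space X"
  unfolding Q_space_def
proof (intro allI impI)
  fix S assume S: "S \<subseteq> topspace X"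
  have "f ` S \<subseteq> topspace Y"
    using S continuous_map_image_subset_topspace[OF f] by blast
  then have "fsigma_in Y (f ` S)"
    using Y by (simp add: Q_space_def)
  then have "fsigma_in X {x \<in> topspace X. f x \<in> f ` S}"
    by (rule fsigma_in_continuous_map_preimage[OF f])
  also have "{x \<in> topspace X. f x \<in> f ` S} = S"
    using inj S by (auto dest: inj_onD)
  finally show "fsigma_in X S" .
qed

lemma less_q0_imp_less_continuum:
  assumes "|A| <o q0"
  shows "|A| <o |UNIV :: real set|"
  using q0_attained assms by (metis card_of_mono1 ordLess_ordLeq_trans subset_UNIV)

text \<open>Equivalently, the space has a coarser topology that is second countable, Hausdorff and
  zero-dimensional.\<close>
definition countably_clopen_separated :: "'a topology \<Rightarrow> bool"
  where "countably_clopen_separated X \<longleftrightarrow>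
    (\<exists>\<C>. countable \<C> \<and> (\<forall>C \<in> \<C>. openin X C \<and> closedin X C) \<and>
      (\<forall>x \<in> topspace X. \<forall>y \<in> topspace X. x \<noteq> y \<longrightarrow> (\<exists>C \<in> \<C>. x \<in> C \<and> y \<notin> C)))"

text \<open>It suffices to name countably many pairs of sets such that any two distinct points lie in a pair which
  some clopen set separates: choosing one such set for each separable pair loses nothing, since the
  choice works for all points of the pair at once.\<close>
lemma countably_clopen_separatedI:
  assumes \<P>: "countable \<P>"
    and sep: "\<And>x y. \<lbrakk>x \<in> topspace X; y \<in> topspace X; x \<noteq> y\<rbrakk> \<Longrightarrow>
      \<exists>F G C. (F, G) \<in> \<P> \<and> x \<in> F \<and> y \<in> G \<and> openin X C \<and> closedin X C \<and> F \<subseteq> C \<and> G \<inter> C = {}"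
  shows "countably_clopen_separated X"
proof -
  define good where "good p C \<longleftrightarrow> openin X C \<and> closedin X C \<and> fst p \<subseteq> C \<and> snd p \<inter> C = {}" for p C
  define \<C> where "\<C> = (\<lambda>p. SOME C. good p C) ` {p \<in> \<P>. \<exists>C. good p C}"
  have good: "good p (SOME C. good p C)" if "\<exists>C. good p C" for p
    using that by (rule someI_ex)
  have "countable \<C>"
    using \<P> by (simp add: \<C>_def)
  moreover have "openin X C \<and> closedin X C" if "C \<in> \<C>" for C
    using that good by (auto simp: \<C>_def good_def)
  moreover have "\<exists>C \<in> \<C>. x \<in> C \<and> y \<notin> C"
    if xy: "x \<in> topspace X" "y \<in> topspace X" "x \<noteq> y" for x y
  proof -
    obtain F G C where P: "(F, G) \<in> \<P>" "x \<in> F" "y \<in> G" and "good (F, G) C"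
      using sep[OF xy] by (auto simp: good_def)
    then have "good (F, G) (SOME C. good (F, G) C)" "(SOME C. good (F, G) C) \<in> \<C>"
      using good by (auto simp: \<C>_def)
    with P show ?thesis
      by (intro bexI[of _ "SOME C. good (F, G) C"]) (auto simp: good_def)
  qed
  ultimately show ?thesis
    unfolding countably_clopen_separated_def by (intro exI[of _ \<C>]) simp
qed

lemma countably_clopen_separated_continuous_inj_preimage:
  assumes f: "continuous_map X Y f" and inj: "inj_on f (topspace X)"
    and Y: "countably_clopen_separated Y"
  shows "countably_clopen_separated X"
proof -
  obtain \<C> where \<C>: "countable \<C>" "\<And>C. C \<in> \<C> \<Longrightarrow> openin Y C \<and> closedin Y C"
    and sep: "\<And>x y. \<lbrakk>x \<in> topspace Y; y \<in> topspace Y; x \<noteq> y\<rbrakk> \<Longrightarrow> \<exists>C \<in> \<C>. x \<in> C \<and> y \<notin> C"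
    using Y unfolding countably_clopen_separated_def by meson
  let ?pre = "\<lambda>C. {x \<in> topspace X. f x \<in> C}"
  show ?thesis
    unfolding countably_clopen_separated_def
  proof (intro exI conjI ballI impI)
    show "countable (?pre ` \<C>)"
      using \<C> by simp
    show "openin X D" "closedin X D" if "D \<in> ?pre ` \<C>" for D
      using that \<C> openin_continuous_map_preimage[OF f] closedin_continuous_map_preimage[OF f] by auto
    fix x y assume xy: "x \<in> topspace X" "y \<in> topspace X" "x \<noteq> y"
    then have "f x \<noteq> f y" "f x \<in> topspace Y" "f y \<in> topspace Y"
      using inj continuous_map_image_subset_topspace[OF f] by (auto dest: inj_onD)
    then show "\<exists>D \<in> ?pre ` \<C>. x \<in> D \<and> y \<notin> D"
      using sep[of "f x" "f y"] xy by auto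
  qed
qed

text \<open>The Cantor sum of the separating family embeds the points injectively into the reals as a set smaller
  than \<open>q0\<close>, which is a \<open>Q\<close>-space by minimality of \<open>q0\<close>.\<close>
lemma Q_space_if_countably_clopen_separated:
  assumes X: "countably_clopen_separated X" and card: "|topspace X| <o q0"
  shows "Q_space X"
proof -
  obtain \<C> where \<C>: "countable \<C>" "\<And>C. C \<in> \<C> \<Longrightarrow> openin X C \<and> closedin X C"
    and sep: "\<And>x y. \<lbrakk>x \<in> topspace X; y \<in> topspace X; x \<noteq> y\<rbrakk> \<Longrightarrow> \<exists>C \<in> \<C>. x \<in> C \<and> y \<notin> C"
    using X unfolding countably_clopen_separated_def by meson
  \<comment> \<open>The empty set is added because \<open>\<C>\<close> itself may be empty, and then has no enumeration.\<close>
  define C where "C = from_nat_into (insert {} \<C>)"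
  have range_C: "range C = insert {} \<C>"
    using \<C> by (simp add: C_def)
  then have C: "openin X (C i)" "closedin X (C i)" for i
    using \<C> by (metis closedin_empty insertE openin_empty rangeI)+
  define g where "g x = cantor_sum (\<lambda>i. x \<in> C i)" for x
  define B where "B = g ` topspace X"
  have cont: "continuous_map X (top_of_set B) g"
    using continuous_map_cantor_sum[of X C] C by (auto simp: continuous_map_in_subtopology B_def g_def[abs_def])
  have inj: "inj_on g (topspace X)"
  proof (rule inj_onI, rule ccontr)
    fix x y assume xy: "x \<in> topspace X" "y \<in> topspace X" "x \<noteq> y" and "g x = g y"
    then have eq: "(\<lambda>i. x \<in> C i) = (\<lambda>i. y \<in> C i)"
      by (simp only: g_def inj_eq[OF inj_cantor_sum])
    have "(x \<in> C i) = (y \<in> C i)" for i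
      using fun_cong[OF eq] .
    then show False
      using sep[OF xy] range_C by (metis insertI2 rangeE)
  qed
  have "\<not> q0 \<le>o |B|"
  proof
    assume "q0 \<le>o |B|"
    also have "|B| \<le>o |topspace X|"
      unfolding B_def by (rule card_of_image)
    finally show False
      using card not_ordLess_ordLeq by blast
  qed
  then have "Q_space (top_of_set B)"
    using q0_least by blast
  with cont inj show ?thesis
    by (rule Q_space_continuous_inj_preimage)
qed

text \<open>The range of \<open>f\<close> is too small to contain the interval between \<open>a\<close> and \<open>b\<close>. At an omitted value \<open>c\<close>
  the sets \<open>f < c\<close> and \<open>f \<le> c\<close> coincide, hence are clopen.\<close>
lemma clopen_between_level_sets:
  assumes card: "|topspace X| <o |UNIV :: real set|"
    and f: "continuous_map X euclideanreal f" and "a < b"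
  shows "\<exists>C. openin X C \<and> closedin X C \<and>
    {x \<in> topspace X. f x \<le> a} \<subseteq> C \<and> {x \<in> topspace X. b \<le> f x} \<inter> C = {}"
proof -
  have "\<not> {a<..<b} \<subseteq> f ` topspace X"
  proof
    assume "{a<..<b} \<subseteq> f ` topspace X"
    then have "f ` topspace X \<approx> (UNIV :: real set)"
      using \<open>a < b\<close> by (intro eqpoll_real_subset[of a b]) auto
    then have "|UNIV :: real set| =o |f ` topspace X|"
      by (simp add: eqpoll_iff_card_of_ordIso ordIso_symmetric)
    also have "|f ` topspace X| \<le>o |topspace X|"
      by (rule card_of_image)
    finally show False
      using card not_ordLess_ordLeq by blast
  qed
  then obtain c where "c \<in> {a<..<b}" and c_notin: "c \<notin> f ` topspace X"
    by blast
  then have c: "a < c" "c < b"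
    by simp_all
  have "openin X {x \<in> topspace X. f x \<in> {..<c}}"
    using f by (rule openin_continuous_map_preimage) simp
  moreover have "closedin X {x \<in> topspace X. f x \<in> {..<c}}"
  proof -
    have "closedin X {x \<in> topspace X. f x \<in> {..c}}"
      using f by (rule closedin_continuous_map_preimage) simp
    also have "{x \<in> topspace X. f x \<in> {..c}} = {x \<in> topspace X. f x \<in> {..<c}}"
      using c_notin by (auto simp: less_le)
    finally show ?thesis .
  qed
  moreover have "{x \<in> topspace X. f x \<le> a} \<subseteq> {x \<in> topspace X. f x \<in> {..<c}}"
    "{x \<in> topspace X. b \<le> f x} \<inter> {x \<in> topspace X. f x \<in> {..<c}} = {}"
    using c by auto
  ultimately show ?thesis
    by blast
qed

text \<open>Once a clopen set separates two points, the network provides members inside the clopen set and inside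
  its complement, so the countably many pairs of network members suffice.\<close>
lemma nw_countable_imp_countably_clopen_separated:
  assumes "nw_countable X" and fH: "functionally_Hausdorff_space X"
    and card: "|topspace X| <o |UNIV :: real set|"
  shows "countably_clopen_separated X"
proof -
  obtain \<F> where \<F>: "countable \<F>"
    and net: "\<And>U x. \<lbrakk>openin X U; x \<in> U\<rbrakk> \<Longrightarrow> \<exists>F \<in> \<F>. x \<in> F \<and> F \<subseteq> U"
    using assms(1) unfolding nw_countable_def network_of_def by meson
  show ?thesis
  proof (rule countably_clopen_separatedI)
    show "countable (\<F> \<times> \<F>)"
      using \<F> by simp
    fix x y assume xy: "x \<in> topspace X" "y \<in> topspace X" "x \<noteq> y"
    then obtain f where f: "continuous_map X euclideanreal f" "f x \<noteq> f y"
      using fH unfolding functionally_Hausdorff_space_def by blast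
    have "\<exists>C. openin X C \<and> closedin X C \<and> x \<in> C \<and> y \<notin> C"
    proof (cases "f x < f y")
      case True
      from clopen_between_level_sets[OF card f(1) this] show ?thesis
        using xy by blast
    next
      case False
      with f have "- f x < - f y"
        by simp
      moreover have "continuous_map X euclideanreal (\<lambda>x. - f x)"
        using f(1) by (rule continuous_map_minus)
      ultimately show ?thesis
        using clopen_between_level_sets[OF card, of "\<lambda>x. - f x"] xy by blast
    qed
    then obtain C where C: "openin X C" "closedin X C" "x \<in> C" "y \<notin> C"
      by blast
    obtain F where "F \<in> \<F>" "x \<in> F" "F \<subseteq> C"
      using net[OF C(1,3)] by blast
    moreover have "openin X (topspace X - C)" "y \<in> topspace X - C"
      using C xy by auto
    then obtain G where "G \<in> \<F>" "y \<in> G" "G \<subseteq> topspace X - C"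
      using net by meson
    ultimately show "\<exists>F G C. (F, G) \<in> \<F> \<times> \<F> \<and> x \<in> F \<and> y \<in> G \<and>
        openin X C \<and> closedin X C \<and> F \<subseteq> C \<and> G \<inter> C = {}"
      using C by (intro exI[of _ F] exI[of _ G] exI[of _ C]) auto
  qed
qed

section \<open>Metric spaces smaller than the continuum\<close>

text \<open>A. H. Stone's construction. Well-order the points and assign \<open>x\<close> to the least \<open>a\<close> whose
  \<open>\<epsilon>\<close>-ball contains it; among the points assigned to \<open>a\<close>, let \<open>A k a\<close> consist of those that stay in
  that ball together with their own ball of radius \<open>1 / Suc k\<close>. For \<open>a\<close> before \<open>b\<close>, a point of \<open>A k b\<close> lies
  outside the ball about \<open>a\<close>, hence at distance at least \<open>1 / Suc k\<close> from \<open>A k a\<close>.\<close>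
lemma (in Metric_space) separated_pieces_of_balls:
  assumes "0 < \<epsilon>"
  shows "\<exists>A :: nat \<Rightarrow> 'a \<Rightarrow> 'a set.
    (\<forall>x \<in> M. \<exists>k. \<exists>a \<in> M. x \<in> A k a) \<and>
    (\<forall>k a. A k a \<subseteq> M) \<and>
    (\<forall>k. \<forall>a \<in> M. \<forall>x \<in> A k a. mball x (1 / Suc k) \<subseteq> mball a \<epsilon>) \<and>
    (\<forall>k. \<forall>a \<in> M. \<forall>b \<in> M. a \<noteq> b \<longrightarrow> (\<forall>x \<in> A k a. \<forall>y \<in> A k b. 1 / Suc k \<le> d x y))"
proof -
  let ?r = "|M|"
  have wo: "well_order_on M ?r"
    by (rule card_of_well_order_on)
  define A where "A k a = {x \<in> M. mball x (1 / Suc k) \<subseteq> mball a \<epsilon> \<and>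
      (\<forall>b \<in> M. (b, a) \<in> ?r - Id \<longrightarrow> x \<notin> mball b \<epsilon>)}" for k :: nat and a
  have "\<exists>k. \<exists>a \<in> M. x \<in> A k a" if x: "x \<in> M" for x
  proof -
    have wf: "wf (?r - Id)"
      using wo by (simp add: well_order_on_def)
    have "x \<in> {a \<in> M. x \<in> mball a \<epsilon>}"
      using x assms by simp
    with wf obtain a where a: "a \<in> M" "x \<in> mball a \<epsilon>"
      and least: "\<And>b. (b, a) \<in> ?r - Id \<Longrightarrow> b \<notin> {a \<in> M. x \<in> mball a \<epsilon>}"
      by (rule wfE_min) blast
    obtain r where "0 < r" and r: "mball x r \<subseteq> mball a \<epsilon>"
      using openin_mball[of a \<epsilon>] a(2) unfolding openin_mtopology by blast
    then obtain k where "1 / Suc k < r"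
      using nat_approx_posE[of r] by blast
    then have "mball x (1 / Suc k) \<subseteq> mball a \<epsilon>"
      using r mball_subset_concentric[of "1 / Suc k" r x] by simp
    with x a least show ?thesis
      by (auto simp: A_def)
  qed
  moreover have "1 / Suc k \<le> d x y"
    if ab: "a \<in> M" "b \<in> M" "a \<noteq> b" and xy: "x \<in> A k a" "y \<in> A k b" for k a b x y
  proof -
    have *: "1 / Suc k \<le> d x y"
      if "(a, b) \<in> ?r - Id" "a \<in> M" "x \<in> A k a" "y \<in> A k b" for a b x y
    proof (rule ccontr)
      assume "\<not> 1 / Suc k \<le> d x y"
      then have "y \<in> mball x (1 / Suc k)"
        using that by (auto simp: A_def)
      then show False
        using that by (auto simp: A_def)
    qed
    have "(a, b) \<in> ?r - Id \<or> (b, a) \<in> ?r - Id"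
      using wo ab by (auto simp: order_on_defs total_on_def)
    then show ?thesis
      using *[of a b x y] *[of b a y x] ab xy by (auto simp: commute)
  qed
  ultimately show ?thesis
    by (intro exI[of _ A]) (auto simp: A_def)
qed

text \<open>Index the pieces by reals through an injection \<open>j\<close>. Let \<open>x\<close> lie in the piece at \<open>a\<close>, for balls so
  small that \<open>y\<close> is far from that piece. At most one other piece comes within half the separation
  distance of \<open>y\<close>, so a basic open set of reals containing \<open>j a\<close> can avoid its index. The union of the
  pieces with index in this basic set then contains \<open>x\<close> and is bounded away from \<open>y\<close>. Only countably many
  such unions occur.\<close>
lemma (in Metric_space) countably_clopen_separated_mtopology:
  assumes card: "|M| <o |UNIV :: real set|"
  shows "countably_clopen_separated mtopology"
proof -
  have "|M| \<le>o |UNIV :: real set|"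
    using card by (rule ordLess_imp_ordLeq)
  then obtain j :: "'a \<Rightarrow> real" where j: "inj_on j M"
    unfolding card_of_ordLeq[symmetric] by blast
  obtain \<B> :: "real set set" where \<B>: "countable \<B>" "topological_basis \<B>"
    using ex_countable_basis by blast
  define separated_pieces where "separated_pieces n A \<longleftrightarrow>
    (\<forall>x \<in> M. \<exists>k. \<exists>a \<in> M. x \<in> A k a) \<and>
    (\<forall>k a. A k a \<subseteq> M) \<and>
    (\<forall>k. \<forall>a \<in> M. \<forall>x \<in> A k a. mball x (1 / Suc k) \<subseteq> mball a (1 / Suc n)) \<and>
    (\<forall>k. \<forall>a \<in> M. \<forall>b \<in> M. a \<noteq> b \<longrightarrow> (\<forall>x \<in> A k a. \<forall>y \<in> A k b. 1 / Suc k \<le> d x y))"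
    for n and A :: "nat \<Rightarrow> 'a \<Rightarrow> 'a set"
  have "\<forall>n. \<exists>A. separated_pieces n A"
    unfolding separated_pieces_def by (intro allI separated_pieces_of_balls) simp
  then obtain A where A: "\<forall>n. separated_pieces n (A n)"
    by (rule choice[THEN exE])
  note A_unfolded = A[unfolded separated_pieces_def, rule_format]
  have cover: "\<exists>k. \<exists>a \<in> M. x \<in> A n k a" if "x \<in> M" for n x
    by (rule A_unfolded[THEN conjunct1, rule_format, OF that])
  have sub: "A n k a \<subseteq> M" for n k a
    by (rule A_unfolded[THEN conjunct2, THEN conjunct1, rule_format])
  have small: "mball x (1 / Suc k) \<subseteq> mball a (1 / Suc n)" if "a \<in> M" "x \<in> A n k a" for n k a x
    by (rule A_unfolded[THEN conjunct2, THEN conjunct2, THEN conjunct1, rule_format, OF that])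
  have apart: "1 / Suc k \<le> d x y"
    if "a \<in> M" "b \<in> M" "a \<noteq> b" "x \<in> A n k a" "y \<in> A n k b" for n k a b x y
    by (rule A_unfolded[THEN conjunct2, THEN conjunct2, THEN conjunct2, rule_format, OF that])
  define F where "F n k I = (\<Union>a \<in> {a \<in> M. j a \<in> I}. A n k a)" for n k and I :: "real set"
  \<comment> \<open>The radius is half of the distance between different pieces, so that a point cannot be that
    close to two of them.\<close>
  define G where "G k S = M - (\<Union>s \<in> S. mball s (1 / (2 * real (Suc k))))" for k :: nat and S
  have clopen: "\<exists>C. openin mtopology C \<and> closedin mtopology C \<and> F n k I \<subseteq> C \<and> G k (F n k I) \<inter> C = {}"
    for n k I
  proof -
    let ?F = "F n k I"
    have FM: "?F \<subseteq> M"
      using sub by (auto simp: F_def)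
    have closed: "closedin mtopology (G k ?F)"
    proof -
      have "openin mtopology (\<Union>s \<in> ?F. mball s (1 / (2 * real (Suc k))))"
        by (rule openin_Union) blast
      with closedin_topspace have "closedin mtopology (topspace mtopology - (\<Union>s \<in> ?F. mball s (1 / (2 * real (Suc k)))))"
        by (rule closedin_diff)
      then show ?thesis
        by (simp only: G_def topspace_mtopology)
    qed
    have disjoint: "disjnt (mtopology closure_of ?F) (G k ?F)"
    proof -
      have "\<exists>s \<in> ?F. x \<in> mball s (1 / (2 * real (Suc k)))" if x: "x \<in> mtopology closure_of ?F" for x
      proof -
        have "0 < 1 / (2 * real (Suc k))"
          by simp
        then obtain s where "s \<in> ?F" "s \<in> mball x (1 / (2 * real (Suc k)))"
          using x unfolding metric_closure_of by blast
        then show ?thesis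
          by (auto simp: commute)
      qed
      then show ?thesis
        by (auto simp: disjnt_iff G_def)
    qed
    obtain f where f: "continuous_map mtopology euclideanreal f"
      and f0: "f ` (mtopology closure_of ?F) \<subseteq> {0}" and f1: "f ` G k ?F \<subseteq> {1 :: real}"
      by (rule Urysohn_lemma_alt[OF normal_space_mtopology closedin_closure_of closed disjoint])
    have "?F \<subseteq> mtopology closure_of ?F"
      using FM by (intro closure_of_subset) simp
    then have "f x = 0" if "x \<in> ?F" for x
      using f0 that by blast
    then have F_sub: "?F \<subseteq> {x \<in> topspace mtopology. f x \<le> 0}"
      using FM by auto
    have G_sub: "G k ?F \<subseteq> {x \<in> topspace mtopology. 1 \<le> f x}"
      using f1 by (auto simp: G_def)
    have "|topspace mtopology| <o |UNIV :: real set|"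
      using card by simp
    then have "\<exists>C. openin mtopology C \<and> closedin mtopology C \<and>
        {x \<in> topspace mtopology. f x \<le> 0} \<subseteq> C \<and> {x \<in> topspace mtopology. 1 \<le> f x} \<inter> C = {}"
      using f zero_less_one by (rule clopen_between_level_sets)
    then show ?thesis
    proof (elim exE conjE, intro exI conjI)
      fix C
      assume "{x \<in> topspace mtopology. f x \<le> 0} \<subseteq> C" "{x \<in> topspace mtopology. 1 \<le> f x} \<inter> C = {}"
      with F_sub G_sub show "?F \<subseteq> C" "G k ?F \<inter> C = {}"
        by blast+
    qed
  qed
  show ?thesis
  proof (rule countably_clopen_separatedI)
    show "countable ((\<lambda>(n, k, I). (F n k I, G k (F n k I))) ` (UNIV \<times> UNIV \<times> \<B>))"
      using \<B> by simp
    fix x y assume "x \<in> topspace mtopology" "y \<in> topspace mtopology" "x \<noteq> y"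
    then have xy: "x \<in> M" "y \<in> M" and "0 < d x y / 2"
      by simp_all
    then obtain n where n: "1 / Suc n < d x y / 2"
      using nat_approx_posE by metis
    obtain k a where a: "a \<in> M" "x \<in> A n k a"
      using cover[OF xy(1)] by blast
    \<comment> \<open>\<open>near b\<close>: the piece at \<open>b\<close> has to be left out of the union that is to be separated from \<open>y\<close>.\<close>
    define near where "near = (\<lambda>b. \<exists>w \<in> A n k b. d y w < 1 / (2 * real (Suc k)))"
    have half: "1 / (2 * real (Suc k)) + 1 / (2 * real (Suc k)) = 1 / real (Suc k)"
      by (simp add: field_simps)
    have half_less: "1 / (2 * real (Suc k)) < 1 / real (Suc k)"
      by (simp add: field_simps)
    have not_near_a: "\<not> near a"
    proof
      assume "near a"
      then obtain w where w: "w \<in> A n k a" "d y w < 1 / (2 * real (Suc k))"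
        by (auto simp: near_def)
      then have "y \<in> mball w (1 / Suc k)"
        using xy sub half_less by (force simp: commute)
      then have "d a y < 1 / Suc n"
        using small[OF a(1) w(1)] by auto
      moreover have "x \<in> mball x (1 / Suc k)"
        using xy by (intro centre_in_mball_iff[THEN iffD2]) simp
      then have "d a x < 1 / Suc n"
        using subsetD[OF small[OF a]] by (simp only: in_mball)
      ultimately show False
        using n triangle[of x a y] xy a(1) by (simp add: commute)
    qed
    have near_unique: "b = c" if near: "near b" "near c" and bc: "b \<in> M" "c \<in> M" for b c
    proof (rule ccontr)
      assume "b \<noteq> c"
      obtain v w where vw: "v \<in> A n k b" "w \<in> A n k c"
        and less: "d y v < 1 / (2 * real (Suc k))" "d y w < 1 / (2 * real (Suc k))"
        using near by (auto simp: near_def)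
      have "1 / Suc k \<le> d v w"
        using apart bc \<open>b \<noteq> c\<close> vw by blast
      also have "\<dots> \<le> d y v + d y w"
        using triangle[of v y w] vw sub xy by (metis commute subsetD)
      also have "\<dots> < 1 / real (Suc k)"
        using add_strict_mono[OF less] unfolding half .
      finally show False
        by simp
    qed
    have open_far: "open (- j ` {b \<in> M. near b})"
    proof -
      have "finite {b \<in> M. near b}"
      proof (cases "\<exists>c \<in> M. near c")
        case True
        then obtain c where "c \<in> M" "near c"
          by blast
        then have "{b \<in> M. near b} \<subseteq> {c}"
          using near_unique by blast
        then show ?thesis
          by (rule finite_subset) simp
      next
        case False
        then have "{b \<in> M. near b} = {}"
          by blast
        then show ?thesis
          by (simp only: finite.emptyI)
      qed
      then have "finite (j ` {b \<in> M. near b})"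
        by (rule finite_imageI)
      then show ?thesis
        by (intro open_Compl finite_imp_closed)
    qed
    have "j a \<in> - j ` {b \<in> M. near b}"
      using not_near_a inj_onD[OF j _ a(1)] by fastforce
    with open_far obtain I where I: "I \<in> \<B>" "j a \<in> I" "I \<subseteq> - j ` {b \<in> M. near b}"
      by (rule topological_basisE[OF \<B>(2)])
    have x_in: "x \<in> F n k I"
      unfolding F_def using a I(2) by blast
    have "y \<notin> mball s (1 / (2 * real (Suc k)))" if s: "s \<in> F n k I" for s
    proof
      assume "y \<in> mball s (1 / (2 * real (Suc k)))"
      then have "d y s < 1 / (2 * real (Suc k))"
        by (simp only: in_mball commute)
      moreover obtain b where "b \<in> M" "j b \<in> I" "s \<in> A n k b"
        using s unfolding F_def by blast
      ultimately have "near b" "b \<in> M" "j b \<in> I"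
        unfolding near_def by blast+
      then show False
        using I(3) by blast
    qed
    then have y_in: "y \<in> G k (F n k I)"
      unfolding G_def using xy(2) by blast
    obtain C where "openin mtopology C \<and> closedin mtopology C \<and> F n k I \<subseteq> C \<and> G k (F n k I) \<inter> C = {}"
      using clopen[of n k I] by (rule exE)
    moreover have "(F n k I, G k (F n k I)) \<in> (\<lambda>(n, k, I). (F n k I, G k (F n k I))) ` (UNIV \<times> UNIV \<times> \<B>)"
      by (rule image_eqI[of _ _ "(n, k, I)"]) (simp_all only: I(1) split mem_Times_iff UNIV_I fst_conv snd_conv simp_thms)
    ultimately show "\<exists>P Q C. (P, Q) \<in> (\<lambda>(n, k, I). (F n k I, G k (F n k I))) ` (UNIV \<times> UNIV \<times> \<B>) \<and>
        x \<in> P \<and> y \<in> Q \<and> openin mtopology C \<and> closedin mtopology C \<and> P \<subseteq> C \<and> Q \<inter> C = {}"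
      using x_in y_in by (intro exI conjI) (assumption | elim conjE)+
  qed
qed

lemma submetrizable_imp_countably_clopen_separated:
  assumes "submetrizable_space X" and card: "|topspace X| <o |UNIV :: real set|"
  shows "countably_clopen_separated X"
  using assms(1) unfolding submetrizable_space_def
proof (elim exE conjE)
  fix M :: "'a set" and d f
  assume M: "Metric_space M d"
    and f: "continuous_map X (Metric_space.mtopology M d) f" "bij_betw f (topspace X) M"
  have "|M| =o |topspace X|"
    using f(2) by (rule ordIso_symmetric[OF card_of_ordIsoI])
  then have "|M| <o |UNIV :: real set|"
    using card by (rule ordIso_ordLess_trans)
  then have "countably_clopen_separated (Metric_space.mtopology M d)"
    by (rule Metric_space.countably_clopen_separated_mtopology[OF M])
  with f show ?thesis
    by (intro countably_clopen_separated_continuous_inj_preimage[of X _ f])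
      (auto simp: bij_betw_def)
qed

section \<open>Adjoining an open set\<close>

text \<open>The coarsest topology that refines \<open>X\<close> and makes \<open>S\<close> open, for \<open>S \<subseteq> topspace X\<close>.\<close>
definition adjoin_open :: "'a topology \<Rightarrow> 'a set \<Rightarrow> 'a topology"
  where "adjoin_open X S = topology (\<lambda>W. \<exists>U V. openin X U \<and> openin X V \<and> W = U \<union> V \<inter> S)"

lemma openin_adjoin_open:
  "openin (adjoin_open X S) W \<longleftrightarrow> (\<exists>U V. openin X U \<and> openin X V \<and> W = U \<union> V \<inter> S)"
proof -
  have "istopology (\<lambda>W. \<exists>U V. openin X U \<and> openin X V \<and> W = U \<union> V \<inter> S)"
    unfolding istopology_def
  proof (intro conjI allI impI)
    fix W W'
    assume "\<exists>U V. openin X U \<and> openin X V \<and> W = U \<union> V \<inter> S"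
      and "\<exists>U V. openin X U \<and> openin X V \<and> W' = U \<union> V \<inter> S"
    then obtain U V U' V' where *: "openin X U" "openin X V" "W = U \<union> V \<inter> S"
      "openin X U'" "openin X V'" "W' = U' \<union> V' \<inter> S"
      by blast
    then have "W \<inter> W' = U \<inter> U' \<union> (U \<inter> V' \<union> V \<inter> U' \<union> V \<inter> V') \<inter> S"
      by blast
    with * show "\<exists>U V. openin X U \<and> openin X V \<and> W \<inter> W' = U \<union> V \<inter> S"
      by (metis openin_Int openin_Un)
  next
    fix \<W> assume "\<forall>W \<in> \<W>. \<exists>U V. openin X U \<and> openin X V \<and> W = U \<union> V \<inter> S"
    then obtain U V where *: "\<And>W. W \<in> \<W> \<Longrightarrow> openin X (U W) \<and> openin X (V W) \<and> W = U W \<union> V W \<inter> S"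
      by metis
    then have "\<Union>\<W> = (\<Union>W\<in>\<W>. U W) \<union> (\<Union>W\<in>\<W>. V W) \<inter> S"
      by blast
    moreover have "openin X (\<Union>W\<in>\<W>. U W)" "openin X (\<Union>W\<in>\<W>. V W)"
      using * by blast+
    ultimately show "\<exists>U V. openin X U \<and> openin X V \<and> \<Union>\<W> = U \<union> V \<inter> S"
      by blast
  qed
  then show ?thesis
    by (simp add: adjoin_open_def topology_inverse')
qed

lemma openin_imp_openin_adjoin_open: "openin X U \<Longrightarrow> openin (adjoin_open X S) U"
  unfolding openin_adjoin_open by (intro exI[of _ U] exI[of _ "{}"]) simp

lemma topspace_adjoin_open [simp]: "topspace (adjoin_open X S) = topspace X"
proof (rule antisym)
  show "topspace (adjoin_open X S) \<subseteq> topspace X"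
    using openin_topspace[of "adjoin_open X S"] openin_subset[of X] unfolding openin_adjoin_open by blast
  show "topspace X \<subseteq> topspace (adjoin_open X S)"
    by (intro openin_subset openin_imp_openin_adjoin_open) simp
qed

lemma continuous_map_adjoin_open: "continuous_map X Y f \<Longrightarrow> continuous_map (adjoin_open X S) Y f"
  by (auto simp: continuous_map_def intro: openin_imp_openin_adjoin_open)

text \<open>Making \<open>S\<close> open creates no new \<open>F\<^sub>\<sigma>\<close> representation of \<open>S\<close>: if the complement of a newly closed set
  \<open>C \<subseteq> S\<close> is \<open>U \<union> V \<inter> S\<close>, then \<open>U\<close> alone covers the complement of \<open>S\<close>, so the complement of \<open>U\<close> is a
  set between \<open>C\<close> and \<open>S\<close> that is closed in the original topology.\<close>
lemma fsigma_in_if_fsigma_in_adjoin_open: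
  assumes S: "S \<subseteq> topspace X" and "fsigma_in (adjoin_open X S) S"
  shows "fsigma_in X S"
proof -
  obtain C :: "nat \<Rightarrow> _" where C: "\<And>n. closedin (adjoin_open X S) (C n)" and S_eq: "\<Union>(range C) = S"
    using assms(2) unfolding fsigma_in_ascending by blast
  have "\<exists>D. closedin X D \<and> C n \<subseteq> D \<and> D \<subseteq> S" for n
  proof -
    have "openin (adjoin_open X S) (topspace X - C n)"
      using C[of n] by (simp add: closedin_def)
    then obtain U V where UV: "openin X U" "topspace X - C n = U \<union> V \<inter> S"
      unfolding openin_adjoin_open by blast
    have "C n \<subseteq> topspace X" "C n \<subseteq> S"
      using S S_eq by auto
    with UV S have "C n \<subseteq> topspace X - U" "topspace X - U \<subseteq> S"
      by blast+
    then show ?thesis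
      using UV(1) by blast
  qed
  then obtain D where D: "\<And>n. closedin X (D n) \<and> C n \<subseteq> D n \<and> D n \<subseteq> S"
    by metis
  then have "S = (\<Union>n. D n)"
    using S_eq by blast
  moreover have "fsigma_in X (\<Union>n. D n)"
    using D by (intro fsigma_in_Union) (auto intro: closed_imp_fsigma_in)
  ultimately show ?thesis
    by simp
qed

lemma not_perfect_adjoin_open:
  assumes "S \<subseteq> topspace X" "\<not> fsigma_in X S"
  shows "\<not> perfect_fsigma_space (adjoin_open X S)"
proof -
  have "openin (adjoin_open X S) S"
    unfolding openin_adjoin_open using assms(1) by (intro exI[of _ "{}"] exI[of _ "topspace X"]) auto
  then show ?thesis
    using fsigma_in_if_fsigma_in_adjoin_open assms unfolding perfect_fsigma_space_def by blast
qed

lemma second_countable_adjoin_open: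
  assumes "second_countable X"
  shows "second_countable (adjoin_open X S)"
proof -
  obtain \<B> where \<B>: "countable \<B>" "\<And>V. V \<in> \<B> \<Longrightarrow> openin X V"
    and base: "\<And>U x. \<lbrakk>openin X U; x \<in> U\<rbrakk> \<Longrightarrow> \<exists>V \<in> \<B>. x \<in> V \<and> V \<subseteq> U"
    using assms unfolding second_countable_def by meson
  show ?thesis
    unfolding second_countable_def
  proof (intro exI conjI ballI allI impI)
    show "countable (\<B> \<union> (\<lambda>V. V \<inter> S) ` \<B>)"
      using \<B>(1) by simp
    show "openin (adjoin_open X S) V" if "V \<in> \<B> \<union> (\<lambda>V. V \<inter> S) ` \<B>" for V
      using that \<B>(2) unfolding openin_adjoin_open by (metis (no_types, lifting) Un_iff Un_empty_left
          Un_empty_right imageE inf_bot_left openin_empty)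
    fix W x assume "openin (adjoin_open X S) W \<and> x \<in> W"
    then obtain U V where UV: "openin X U" "openin X V" "W = U \<union> V \<inter> S"
      and "x \<in> U \<or> x \<in> V \<and> x \<in> S"
      unfolding openin_adjoin_open by blast
    then consider B where "B \<in> \<B>" "x \<in> B" "B \<subseteq> U" | B where "B \<in> \<B>" "x \<in> B \<inter> S" "B \<subseteq> V"
      using base by (metis IntI)
    then show "\<exists>V \<in> \<B> \<union> (\<lambda>V. V \<inter> S) ` \<B>. x \<in> V \<and> V \<subseteq> W"
    proof cases
      case 1
      then show ?thesis
        using UV(3) by (intro bexI[of _ B]) auto
    next
      case 2
      then show ?thesis
        using UV(3) by (intro bexI[of _ "B \<inter> S"]) auto
    qed
  qed
qed

section \<open>The cardinal q0 as a minimum\<close>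

lemma Q_space_imp_perfect: "Q_space X \<Longrightarrow> perfect_fsigma_space X"
  by (simp add: Q_space_def perfect_fsigma_space_def openin_subset)

lemma second_countable_imp_nw_countable: "second_countable X \<Longrightarrow> nw_countable X"
  unfolding second_countable_def nw_countable_def network_of_def by (meson openin_subset)

lemma q0_le_if_not_Q_space:
  assumes "\<not> Q_space X"
    and "submetrizable_space X \<or> nw_countable X \<and> functionally_Hausdorff_space X"
  shows "q0 \<le>o |topspace X|"
proof (rule ccontr)
  assume "\<not> q0 \<le>o |topspace X|"
  moreover have "Well_order q0"
    using q0_attained card_of_Well_order by metis
  ultimately have less: "|topspace X| <o q0"
    using not_ordLeq_iff_ordLess card_of_Well_order by blast
  then have "|topspace X| <o |UNIV :: real set|"
    by (rule less_q0_imp_less_continuum)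
  then have "countably_clopen_separated X"
    using assms(2) submetrizable_imp_countably_clopen_separated
      nw_countable_imp_countably_clopen_separated by blast
  then show False
    using Q_space_if_countably_clopen_separated less assms(1) by blast
qed

lemma q0_attained_by_non_perfect_space:
  "\<exists>X :: real topology. submetrizable_space X \<and> second_countable X \<and>
    functionally_Hausdorff_space X \<and> \<not> perfect_fsigma_space X \<and> |topspace X| =o q0"
proof -
  obtain A :: "real set" where A: "\<not> Q_space (top_of_set A)" "q0 = |A|"
    using q0_attained by blast
  then obtain S where S: "S \<subseteq> A" "\<not> fsigma_in (top_of_set A) S"
    by (auto simp: Q_space_def)
  let ?X = "adjoin_open (top_of_set A) S"
  have "submetrizable_space ?X"
    unfolding submetrizable_space_def
  proof (intro exI conjI)
    interpret Submetric UNIV dist A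
      by unfold_locales auto
    show "Metric_space A dist"
      by (rule sub.Metric_space_axioms)
    show "continuous_map ?X sub.mtopology id"
      by (intro continuous_map_adjoin_open) (simp add: mtopology_submetric)
    show "bij_betw id (topspace ?X) A"
      by simp
  qed
  moreover have "second_countable euclideanreal"
  proof -
    obtain \<B> :: "real set set" where \<B>: "countable \<B>" "topological_basis \<B>"
      using ex_countable_basis by blast
    have "\<exists>V \<in> \<B>. x \<in> V \<and> V \<subseteq> U" if "open U" "x \<in> U" for U x
      by (rule topological_basisE[OF \<B>(2) that]) blast
    then show ?thesis
      unfolding second_countable_def
      using \<B> by (intro exI[of _ \<B>]) (simp add: topological_basis_open)
  qed
  then have "second_countable ?X"
    by (intro second_countable_adjoin_open second_countable_subtopology)
  moreover have "functionally_Hausdorff_space ?X"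
    unfolding functionally_Hausdorff_space_def
    by (auto intro!: exI[of _ id] continuous_map_adjoin_open)
  moreover have "\<not> perfect_fsigma_space ?X"
    using S by (intro not_perfect_adjoin_open) auto
  moreover have "|topspace ?X| =o q0"
    by (simp add: A card_of_refl)
  ultimately show ?thesis
    by blast
qed

(* In each of the six clauses the minimum over all spaces is expressed by a lower bound for the
  spaces over an arbitrary type 'a, which is attained by a space over the reals. *)

theorem proposition4:
  shows "
     ((\<exists>X :: real topology. submetrizable_space X \<and> \<not> Q_space X \<and>
         |topspace X| =o q0) \<and>
      (\<forall>X :: 'a topology. submetrizable_space X \<and> \<not> Q_space X \<longrightarrow>
         q0 \<le>o |topspace X| )) \<and>
     ((\<exists>X :: real topology. submetrizable_space X \<and> \<not> perfect_fsigma_space X \<and>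
         |topspace X| =o q0) \<and>
      (\<forall>X :: 'a topology. submetrizable_space X \<and> \<not> perfect_fsigma_space X \<longrightarrow>
         q0 \<le>o |topspace X| )) \<and>
     ((\<exists>X :: real topology. nw_countable X \<and> functionally_Hausdorff_space X \<and> \<not> Q_space X \<and>
         |topspace X| =o q0) \<and>
      (\<forall>X :: 'a topology. nw_countable X \<and> functionally_Hausdorff_space X \<and> \<not> Q_space X \<longrightarrow>
         q0 \<le>o |topspace X| )) \<and>
     ((\<exists>X :: real topology. nw_countable X \<and> functionally_Hausdorff_space X \<and> \<not> perfect_fsigma_space X \<and>
         |topspace X| =o q0) \<and>
      (\<forall>X :: 'a topology. nw_countable X \<and> functionally_Hausdorff_space X \<and> \<not> perfect_fsigma_space X \<longrightarrow>
         q0 \<le>o |topspace X| )) \<and>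
     ((\<exists>X :: real topology. second_countable X \<and> functionally_Hausdorff_space X \<and> \<not> Q_space X \<and>
         |topspace X| =o q0) \<and>
      (\<forall>X :: 'a topology. second_countable X \<and> functionally_Hausdorff_space X \<and> \<not> Q_space X \<longrightarrow>
         q0 \<le>o |topspace X| )) \<and>
     ((\<exists>X :: real topology. second_countable X \<and> functionally_Hausdorff_space X \<and> \<not> perfect_fsigma_space X \<and>
         |topspace X| =o q0) \<and>
      (\<forall>X :: 'a topology. second_countable X \<and> functionally_Hausdorff_space X \<and> \<not> perfect_fsigma_space X \<longrightarrow>
         q0 \<le>o |topspace X| ))"
proof -
  obtain X :: "real topology" where X: "submetrizable_space X" "second_countable X"
    "functionally_Hausdorff_space X" "\<not> perfect_fsigma_space X" "|topspace X| =o q0"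
    using q0_attained_by_non_perfect_space by blast
  have nw: "nw_countable X"
    using X(2) by (rule second_countable_imp_nw_countable)
  have not_Q: "\<not> Q_space X"
    using X(4) Q_space_imp_perfect by blast
  have lower: "q0 \<le>o |topspace Y|"
    if "\<not> Q_space Y \<or> \<not> perfect_fsigma_space Y"
      and "submetrizable_space Y \<or>
        (nw_countable Y \<or> second_countable Y) \<and> functionally_Hausdorff_space Y"
    for Y :: "'a topology"
    using that q0_le_if_not_Q_space Q_space_imp_perfect second_countable_imp_nw_countable by metis
  show ?thesis
    by (intro conjI allI impI; (rule exI[of _ X], simp add: X nw not_Q)?; (rule lower; simp)?)
qed

end
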